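(* Let $\mathbf{X}=(X_1,\dots,X_n)$ and $\mathbf{Y}=(Y_1,\dots,Y_n)$ be vectors of $n$ independent Bernoulli random variables with success probabilities $p_1,\dots,p_n$ and $q_1,\dots,q_n$, respectively, where $0<p_i\le q_i<1$ for all $i\in\{1,\dots,n\}$. Put $\beta_i:=\frac{p_i}{1-p_i}\,\frac{1-q_i}{q_i}$. If all $\beta_i$ ($i\in\{1,\dots,n\}$) are equal, then for all $k\in\{0,1,\dots,n\}$, $$\mathcal{L}\Bigl(\mathbf{X}\Bigm|\sum_{i=1}^nX_i\ge k\Bigr)\preceq\mathcal{L}\Bigl(\mathbf{Y}\Bigm|\sum_{i=1}^nY_i\ge k\Bigr).$$
   Context: $\mathcal{L}(\mathbf{X}\mid A)$ denotes the conditional law of $\mathbf{X}$ given the event $A$. For laws $\mu,\nu$ on $\mathbb{R}^n$, $\mu\preceq\nu$ (stochastic domination) means that there exist random vectors $\mathbf{U}$ with law $\mu$ and $\mathbf{V}$ with law $\nu$ on a common probability space such that $\mathbf{U}\le\mathbf{V}$ componentwise with probability $1$. *)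

theory Defs
  imports "HOL-Probability.Probability"
begin

definition bernoulli_law :: "real \<Rightarrow> real measure" where
  "bernoulli_law p = distr (measure_pmf (bernoulli_pmf p)) borel of_bool"

(* Bernoulli variables are real-valued and specified by their law only: they take values in {0, 1}
   almost surely. *)
definition indep_bernoulli_vector :: "'a measure \<Rightarrow> ('n::finite \<Rightarrow> real) \<Rightarrow> ('a \<Rightarrow> real ^ 'n) \<Rightarrow> bool" where
  "indep_bernoulli_vector M p X \<longleftrightarrow>
     prob_space M \<and>
     prob_space.indep_vars M (\<lambda>_. borel) (\<lambda>i \<omega>. X \<omega> $ i) UNIV \<and>
     (\<forall>i. distr M borel (\<lambda>\<omega>. X \<omega> $ i) = bernoulli_law (p i))"

(* uniform_measure M A is the conditional measure B \<mapsto> M (A \<inter> B) / M A. It is a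
   probability measure only if A is an event of positive probability. *)
definition cond_law :: "'a measure \<Rightarrow> ('a \<Rightarrow> real ^ 'n::finite) \<Rightarrow> 'a set \<Rightarrow> (real ^ 'n) measure" where
  "cond_law M X A = distr (uniform_measure M A) borel X"

(* The order on real ^ 'n is componentwise. HOL cannot quantify over the type of the common
   sample space, so it is fixed to pairs of vectors; stoch_dominatedI shows that
   this loses nothing, as a coupling on any sample space can be replaced by its joint law. *)
definition stoch_dominated :: "(real ^ 'n::finite) measure \<Rightarrow> (real ^ 'n) measure \<Rightarrow> bool"
    (infix "\<preceq>\<^sub>s\<^sub>t" 50) where
  "\<mu> \<preceq>\<^sub>s\<^sub>t \<nu> \<longleftrightarrow>
     (\<exists>(P :: ((real ^ 'n) \<times> (real ^ 'n)) measure) U V.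
        prob_space P \<and> U \<in> borel_measurable P \<and> V \<in> borel_measurable P \<and>
        distr P borel U = \<mu> \<and> distr P borel V = \<nu> \<and> (AE \<omega> in P. U \<omega> \<le> V \<omega>))"

lemma stoch_dominatedI:
  fixes U V :: "'a \<Rightarrow> real ^ 'n::finite"
  assumes P: "prob_space P"
    and U[measurable]: "U \<in> borel_measurable P" and V[measurable]: "V \<in> borel_measurable P"
    and le: "AE \<omega> in P. U \<omega> \<le> V \<omega>"
  shows "distr P borel U \<preceq>\<^sub>s\<^sub>t distr P borel V"
proof -
  let ?Q = "distr P (borel \<Otimes>\<^sub>M borel) (\<lambda>\<omega>. (U \<omega>, V \<omega>))"
  have "prob_space ?Q"
    by (rule prob_space.prob_space_distr[OF P]) measurable
  moreover have "fst \<in> borel_measurable ?Q" "snd \<in> borel_measurable ?Q"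
    by simp_all
  moreover have "distr ?Q borel fst = distr P borel U" "distr ?Q borel snd = distr P borel V"
    by (simp_all add: distr_distr comp_def)
  moreover have "AE \<omega> in ?Q. fst \<omega> \<le> snd \<omega>"
  proof -
    have "{x \<in> space (borel \<Otimes>\<^sub>M borel). fst x \<le> (snd x :: real ^ 'n)} \<in> sets (borel \<Otimes>\<^sub>M borel)"
    proof -
      have "closed {x :: (real ^ 'n) \<times> (real ^ 'n). \<forall>i. fst x $ i \<le> snd x $ i}"
        by (intro closed_Collect_all closed_Collect_le continuous_intros)
      then show ?thesis
        unfolding borel_prod less_eq_vec_def by (simp add: borel_closed)
    qed
    then show ?thesis
      using le by (simp add: AE_distr_iff)
  qed
  ultimately show ?thesis
    unfolding stoch_dominated_def by blast
qed

definition odds_ratio :: "real \<Rightarrow> real \<Rightarrow> real" where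
  "odds_ratio a b = a / (1 - a) * ((1 - b) / b)"

end

theory Submission
  imports Defs
begin

text \<open>
  Identify a 0/1 vector with a subset \<open>S\<close> of the index set. If all odds ratios equal \<open>\<beta>\<close>, then
  \<open>P(X = S)\<close> is proportional to \<open>\<beta>\<^sup>|\<^sup>S\<^sup>| P(Y = S)\<close>. Hence \<open>X\<close> and \<open>Y\<close> have the same law \<open>\<mu>\<^sub>m\<close> given that the
  sum is \<open>m\<close>, and, as \<open>\<beta> \<le> 1\<close>, the two conditioned laws can be coupled so that the sum for \<open>X\<close> is at most
  the sum for \<open>Y\<close>. It remains to couple \<open>\<mu>\<^sub>m\<close> with \<open>\<mu>\<^sub>m\<^sub>+\<^sub>1\<close> monotonically: draw \<open>S\<close> from \<open>\<mu>\<^sub>m\<close> and \<open>T\<close> from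
  \<open>\<mu>\<^sub>m\<^sub>+\<^sub>1\<close> independently, and then \<open>j\<close> uniformly from \<open>T - S\<close>. Moving \<open>j\<close> from \<open>T\<close> to \<open>S\<close> and exchanging the
  two sets preserves the law of \<open>(S, T, j)\<close>, because the weights are multiplicative and \<open>|T - S|\<close>
  does not change. So \<open>S \<union> {j}\<close> has law \<open>\<mu>\<^sub>m\<^sub>+\<^sub>1\<close>.
\<close>

section \<open>Couplings of discrete laws\<close>

lemma pmf_bind_map_Pair:
  "pmf (bind_pmf p (\<lambda>x. map_pmf (Pair x) (f x))) (x, y) = pmf p x * pmf (f x) y"
proof -
  have *: "pmf (map_pmf (Pair x') (f x')) (x, y) = indicator {x} x' * pmf (f x) y" for x'
  proof (cases "x' = x")
    case True
    then show ?thesis by (simp add: pmf_map_inj' inj_on_def)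
  next
    case False
    then show ?thesis by (auto simp: pmf_eq_0_set_pmf)
  qed
  show ?thesis
    by (simp add: pmf_bind * measure_pmf_single)
qed

lemma rel_pmf_pmf_mult_less:
  fixes p q :: "'a::finite pmf"
  shows "rel_pmf (\<lambda>x y. x = y \<or> pmf p y * pmf q x < pmf p x * pmf q y) p q"
proof -
  \<comment> \<open>From the independent coupling, the part of the mass that is symmetric in the two arguments is
    moved to the diagonal; by symmetry this changes neither marginal.\<close>
  define m where "m x y = min (pmf p x * pmf q y) (pmf p y * pmf q x)" for x y
  define g where "g = (\<lambda>(x, y). pmf p x * pmf q y - m x y + (if x = y then \<Sum>z\<in>UNIV. m x z else 0))"
  have m_commute: "m x y = m y x" for x y
    by (simp add: m_def min.commute mult.commute)
  have g_nonneg: "0 \<le> g z" for z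
    by (cases z) (auto simp: g_def m_def intro!: add_nonneg_nonneg sum_nonneg)
  have sum_pmf: "(\<Sum>x\<in>UNIV. pmf r x) = 1" for r :: "'a pmf"
    by (rule sum_pmf_eq_1) auto
  have row: "(\<Sum>y\<in>UNIV. g (x, y)) = pmf p x" for x
    by (simp add: g_def sum.distrib sum_subtractf sum.delta' flip: sum_distrib_left)
       (simp add: sum_pmf)
  have col: "(\<Sum>x\<in>UNIV. g (x, y)) = pmf q y" for y
    by (simp add: g_def sum.distrib sum_subtractf sum.delta' m_commute[of _ y] flip: sum_distrib_right)
       (simp add: sum_pmf)
  have "(\<Sum>z\<in>UNIV. g z) = (\<Sum>x\<in>UNIV. \<Sum>y\<in>UNIV. g (x, y))"
    by (simp add: sum.cartesian_product flip: UNIV_Times_UNIV)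
  also have "\<dots> = 1"
    by (simp add: row sum_pmf)
  finally have total: "(\<integral>\<^sup>+z. ennreal (g z) \<partial>count_space UNIV) = 1"
    by (simp add: nn_integral_count_space_finite sum_ennreal g_nonneg)
  define r where "r = embed_pmf g"
  have pmf_r: "pmf r z = g z" for z
    unfolding r_def using g_nonneg total by (rule pmf_embed_pmf)
  show ?thesis
  proof (rule rel_pmf.intros[of r])
    fix x y assume "(x, y) \<in> set_pmf r"
    then have "g (x, y) \<noteq> 0"
      by (simp add: set_pmf_iff pmf_r)
    \<comment> \<open>Off the diagonal, \<open>g\<close> is the independent mass minus the minimum
      \<open>m x y\<close>, so it is nonzero only if the swapped product is strictly
      smaller.\<close>
    then show "x = y \<or> pmf p y * pmf q x < pmf p x * pmf q y"
      by (auto simp: g_def m_def min_def split: if_splits)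
  next
    show "map_pmf fst r = p"
    proof (rule pmf_eqI)
      fix x
      have "(fst :: 'a \<times> 'a \<Rightarrow> 'a) -` {x} = Pair x ` UNIV" by auto
      then show "pmf (map_pmf fst r) x = pmf p x"
        by (simp add: pmf_map measure_measure_pmf_finite pmf_r sum.reindex inj_on_def row)
    qed
    show "map_pmf snd r = q"
    proof (rule pmf_eqI)
      fix y
      have "(snd :: 'a \<times> 'a \<Rightarrow> 'a) -` {y} = (\<lambda>x. (x, y)) ` UNIV" by auto
      then show "pmf (map_pmf snd r) y = pmf q y"
        by (simp add: pmf_map measure_measure_pmf_finite pmf_r sum.reindex inj_on_def col)
    qed
  qed
qed

text \<open>By \<open>exchange\<close>, moving \<open>j\<close> from \<open>T\<close> to
  \<open>S\<close> and swapping the two sets preserves the joint law. So \<open>insert j S\<close>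
  has law \<open>q\<close>, and it contains \<open>S\<close>, which has law
  \<open>p\<close>.\<close>

lemma rel_pmf_subset_of_exchange:
  fixes p q :: "'a::finite set pmf"
  assumes p: "\<And>S. S \<in> set_pmf p \<Longrightarrow> card S = m"
    and q: "\<And>T. T \<in> set_pmf q \<Longrightarrow> card T = Suc m"
    and exchange: "\<And>S T j. card S = m \<Longrightarrow> card T = Suc m \<Longrightarrow> j \<in> T - S \<Longrightarrow>
      pmf p (T - {j}) * pmf q (insert j S) = pmf p S * pmf q T"
  shows "rel_pmf (\<subseteq>) p q"
proof -
  define Q where "Q = bind_pmf (pair_pmf p q) (\<lambda>z. map_pmf (Pair z) (pmf_of_set (snd z - fst z)))"
  define ok where "ok = (\<lambda>((S, T), j). card S = m \<and> card T = Suc m \<and> j \<in> T - (S :: 'a set))"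
  \<comment> \<open>Extended by the identity, the exchange is an involution of the whole type, so
    its image law can be computed by injectivity.\<close>
  define \<phi> where "\<phi> = (\<lambda>z. if ok z then case z of ((S, T), j) \<Rightarrow> ((T - {j}, insert j S), j) else z)"
  have nonempty: "T - S \<noteq> {}" if "card S = m" "card T = Suc m" for S T :: "'a set"
    using that card_mono[of S T] by auto
  have ok: "ok z" if "z \<in> set_pmf Q" for z
  proof -
    from that obtain S T j where z: "z = ((S, T), j)" "S \<in> set_pmf p" "T \<in> set_pmf q"
      and j: "j \<in> set_pmf (pmf_of_set (T - S))"
      unfolding Q_def by auto
    have "j \<in> T - S"
      using j nonempty[OF p q, OF z(2,3)] by simp
    with z p q show ?thesis by (simp add: ok_def)
  qed
  have ok_\<phi>: "ok (\<phi> z)" if "ok z" for z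
    using that by (auto simp: ok_def \<phi>_def split: prod.splits)
  have invol: "\<phi> (\<phi> z) = z" for z
  proof (cases "ok z")
    case True
    then show ?thesis
      using ok_\<phi>[OF True] by (auto simp: \<phi>_def ok_def split: prod.splits)
  qed (simp add: \<phi>_def)
  then have inj: "inj \<phi>"
    by (metis injI)
  have pmf_Q: "pmf Q ((S, T), j) = pmf p S * pmf q T * pmf (pmf_of_set (T - S)) j" for S T j
    by (simp add: Q_def pmf_bind_map_Pair pmf_pair)
  have pmf_\<phi>: "pmf Q (\<phi> z) = pmf Q z" for z
  proof (cases "ok z")
    case True
    obtain S T j where z: "z = ((S, T), j)" by (metis surj_pair)
    from True have S: "card S = m" and T: "card T = Suc m" and j: "j \<in> T" "j \<notin> S"
      by (auto simp: z ok_def)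
    \<comment> \<open>The new difference set has the old size because \<open>T\<close> has exactly
      one element more than \<open>S\<close>; hence \<open>j\<close> keeps its conditional
      weight.\<close>
    have eq: "insert j S - (T - {j}) = insert j (S - T)" using j by auto
    have "card (S - T) + card (S \<inter> T) = m" "card (T - S) + card (S \<inter> T) = Suc m"
      using card_Diff_subset_Int[of S T] card_Diff_subset_Int[of T S]
        card_mono[of S "S \<inter> T"] card_mono[of T "S \<inter> T"] S T
      by (auto simp: Int_commute)
    then have "card (insert j (S - T)) = card (T - S)"
      using j by simp
    then show ?thesis
      using True j exchange[OF S T, of j] nonempty[OF S T]
      by (simp add: z \<phi>_def pmf_Q eq indicator_def)
  qed (simp add: \<phi>_def)
  have "map_pmf \<phi> Q = Q"
  proof (rule pmf_eqI)
    fix z show "pmf (map_pmf \<phi> Q) z = pmf Q z"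
      using pmf_map_inj'[OF inj, of Q "\<phi> z"] by (simp add: invol pmf_\<phi>)
  qed
  then have "map_pmf (snd \<circ> fst) Q = map_pmf (snd \<circ> fst \<circ> \<phi>) Q"
    by (metis map_pmf_compose comp_def)
  also have "\<dots> = map_pmf (\<lambda>z. insert (snd z) (fst (fst z))) Q"
    by (rule map_pmf_cong) (auto simp: \<phi>_def dest: ok)
  finally have swap: "map_pmf (\<lambda>z. insert (snd z) (fst (fst z))) Q = map_pmf (snd \<circ> fst) Q" ..
  have fst_Q: "map_pmf fst Q = pair_pmf p q"
    by (simp add: Q_def map_bind_pmf pmf.map_comp comp_def bind_return_pmf')
  show ?thesis
  proof (rule rel_pmf.intros[of "map_pmf (\<lambda>z. (fst (fst z), insert (snd z) (fst (fst z)))) Q"])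
    have "map_pmf (\<lambda>z. fst (fst z)) Q = map_pmf fst (map_pmf fst Q)"
      by (simp add: pmf.map_comp comp_def)
    then show "map_pmf fst (map_pmf (\<lambda>z. (fst (fst z), insert (snd z) (fst (fst z)))) Q) = p"
      by (simp add: pmf.map_comp comp_def fst_Q map_fst_pair_pmf)
    have "map_pmf (snd \<circ> fst) Q = map_pmf snd (map_pmf fst Q)"
      by (simp add: pmf.map_comp)
    then show "map_pmf snd (map_pmf (\<lambda>z. (fst (fst z), insert (snd z) (fst (fst z)))) Q) = q"
      by (simp add: pmf.map_comp comp_def fst_Q map_snd_pair_pmf swap[unfolded comp_def])
  qed auto
qed

text \<open>The factor \<open>c\<close> also multiplies the normalising constant
  \<open>measure q A\<close> and cancels.\<close>

lemma cond_pmf_cong_scale: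
  fixes p q :: "'a::finite pmf"
  assumes q: "set_pmf q \<inter> A \<noteq> {}" and c: "c \<noteq> 0" and scale: "\<And>x. x \<in> A \<Longrightarrow> pmf p x = c * pmf q x"
  shows "cond_pmf p A = cond_pmf q A"
proof -
  have p: "set_pmf p \<inter> A \<noteq> {}"
  proof -
    from q obtain x where "x \<in> set_pmf q" "x \<in> A" by auto
    with c have "x \<in> set_pmf p" by (simp add: set_pmf_iff scale)
    with \<open>x \<in> A\<close> show ?thesis by auto
  qed
  have "measure p A = c * measure q A"
    by (simp add: measure_measure_pmf_finite sum_distrib_left scale)
  then show ?thesis
    using c scale by (intro pmf_eqI) (simp add: pmf_cond p q)
qed

section \<open>Random subsets with independent memberships\<close>

definition random_subset_pmf :: "('n::finite \<Rightarrow> real) \<Rightarrow> 'n set pmf" where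
  "random_subset_pmf p = map_pmf Collect (Pi_pmf UNIV False (\<lambda>i. bernoulli_pmf (p i)))"

lemma pmf_random_subset:
  assumes "\<And>i. 0 \<le> p i \<and> p i \<le> 1"
  shows "pmf (random_subset_pmf p) S = (\<Prod>i\<in>UNIV. if i \<in> S then p i else 1 - p i)"
proof -
  have "pmf (random_subset_pmf p) (Collect (\<lambda>i. i \<in> S)) =
      pmf (Pi_pmf UNIV False (\<lambda>i. bernoulli_pmf (p i))) (\<lambda>i. i \<in> S)"
    unfolding random_subset_pmf_def by (rule pmf_map_inj') (auto simp: inj_def)
  also have "\<dots> = (\<Prod>i\<in>UNIV. if i \<in> S then p i else 1 - p i)"
    using assms by (subst pmf_Pi') (auto intro!: prod.cong)
  finally show ?thesis by simp
qed

lemma set_pmf_random_subset: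
  assumes "\<And>i. 0 < p i \<and> p i < 1"
  shows "set_pmf (random_subset_pmf p) = UNIV"
proof -
  have "pmf (random_subset_pmf p) S > 0" for S
    using assms by (subst pmf_random_subset) (auto intro!: prod_pos simp: less_imp_le)
  then show ?thesis
    by (auto simp: set_pmf_iff) (metis less_irrefl)
qed

text \<open>On both sides \<open>j\<close> contributes one factor \<open>p j\<close> and one factor
  \<open>1 - p j\<close>; at any other index the two factors only trade places.\<close>

lemma pmf_random_subset_exchange:
  assumes "\<And>i. 0 \<le> p i \<and> p i \<le> 1" and "j \<in> T - S"
  shows "pmf (random_subset_pmf p) (T - {j}) * pmf (random_subset_pmf p) (insert j S) =
    pmf (random_subset_pmf p) S * pmf (random_subset_pmf p) T"
  using assms(2) unfolding pmf_random_subset[OF assms(1)] prod.distrib[symmetric]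
  by (intro prod.cong) auto

section \<open>Monotone coupling of the conditioned random subsets\<close>

lemma ex_card_eq:
  assumes "m \<le> CARD('n::finite)"
  shows "\<exists>S :: 'n set. card S = m"
  using obtain_subset_with_card_n[of m "UNIV :: 'n set"] assms by auto

text \<open>Inclusion is transitive, so couplings of consecutive sizes compose, and only the step
  from \<open>l\<close> to \<open>Suc l\<close> needs the exchange argument.\<close>

lemma rel_pmf_subset_cond_card:
  fixes p :: "'n::finite \<Rightarrow> real"
  assumes p: "\<And>i. 0 < p i \<and> p i < 1" and "m \<le> m'" "m' \<le> CARD('n)"
  shows "rel_pmf (\<subseteq>) (cond_pmf (random_subset_pmf p) {S. card S = m})
    (cond_pmf (random_subset_pmf p) {S. card S = m'})"
  using assms(2,3)
proof (induction rule: dec_induct)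
  case base
  show ?case by (rule rel_pmf_reflI) simp
next
  case (step l)
  let ?\<mu> = "\<lambda>m. cond_pmf (random_subset_pmf p) {S. card S = m}"
  have ne: "set_pmf (random_subset_pmf p) \<inter> {S. card S = k} \<noteq> {}" if "k \<le> CARD('n)" for k
    using ex_card_eq[OF that] by (auto simp: set_pmf_random_subset[OF p])
  have "rel_pmf (\<subseteq>) (?\<mu> l) (?\<mu> (Suc l))"
  proof (rule rel_pmf_subset_of_exchange[where m = l])
    show "card S = l" if "S \<in> set_pmf (?\<mu> l)" for S
      using that step.prems by (simp add: set_cond_pmf[OF ne])
    show "card S = Suc l" if "S \<in> set_pmf (?\<mu> (Suc l))" for S
      using that step.prems by (simp add: set_cond_pmf[OF ne])
    \<comment> \<open>Conditioning divides both sides by the same two normalising constants, so the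
      identity for the unconditioned law carries over.\<close>
    show "pmf (?\<mu> l) (T - {j}) * pmf (?\<mu> (Suc l)) (insert j S) = pmf (?\<mu> l) S * pmf (?\<mu> (Suc l)) T"
      if "card S = l" "card T = Suc l" "j \<in> T - S" for S T j
      using that step.prems pmf_random_subset_exchange[of p j T S] p
      by (simp add: pmf_cond[OF ne] less_imp_le)
  qed
  with step have "rel_pmf ((\<subseteq>) OO (\<subseteq>)) (?\<mu> m) (?\<mu> (Suc l))"
    unfolding pmf.rel_compp by (intro relcomppI) auto
  then show ?case
    by (rule pmf.rel_mono_strong) auto
qed

text \<open>Averaging the conditional laws on the fibres, each weighted by its mass, returns the
  law. With \<open>f = card\<close> this splits a draw into a size and then a set of that
  size.\<close>

lemma bind_cond_pmf_fibre:
  "bind_pmf p (\<lambda>x. cond_pmf p {y. f y = f x}) = p"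
proof -
  have "bind_pmf p (\<lambda>x. cond_pmf p {y. f x = f y}) = p"
    by (rule bind_cond_pmf_cancel) (auto simp: eq_commute)
  then show ?thesis by (simp add: eq_commute)
qed

text \<open>Index by index, \<open>p i / q i = \<beta> * (1 - p i) / (1 - q i)\<close>, so each
  member of \<open>S\<close> brings one extra factor \<beta>.\<close>

lemma pmf_random_subset_odds_ratio:
  fixes p q :: "'n::finite \<Rightarrow> real"
  assumes pq: "\<And>i. 0 < p i \<and> p i < 1 \<and> 0 < q i \<and> q i < 1"
    and \<beta>: "\<And>i. odds_ratio (p i) (q i) = \<beta>"
  shows "pmf (random_subset_pmf p) S =
    (\<Prod>i\<in>UNIV. (1 - p i) / (1 - q i)) * \<beta> ^ card S * pmf (random_subset_pmf q) S"
proof -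
  have p': "\<And>i. 0 \<le> p i \<and> p i \<le> 1" and q': "\<And>i. 0 \<le> q i \<and> q i \<le> 1"
    using pq by (auto simp: less_imp_le)
  have "\<beta> ^ card S = (\<Prod>i\<in>UNIV. if i \<in> S then \<beta> else 1)"
    by (simp add: prod.If_cases)
  then show ?thesis
    unfolding pmf_random_subset[OF p'] pmf_random_subset[OF q']
  proof (simp only: prod.distrib[symmetric], intro prod.cong refl)
    fix i
    have "p i \<noteq> 1" "q i \<noteq> 1" "q i \<noteq> 0" using pq[of i] by auto
    then show "(if i \<in> S then p i else 1 - p i) =
        (1 - p i) / (1 - q i) * (if i \<in> S then \<beta> else 1) * (if i \<in> S then q i else 1 - q i)"
      using \<beta>[of i] by (auto simp: odds_ratio_def field_simps)
  qed
qed

text \<open>Two stages: couple the conditioned laws so that sizes are ordered, then redraw each set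
  within its size class, where both laws agree with that of \<open>random_subset_pmf q\<close> and
  can be coupled by inclusion.\<close>

lemma rel_pmf_subset_cond_card_ge:
  fixes p q :: "'n::finite \<Rightarrow> real"
  assumes pq: "\<And>i. 0 < p i \<and> p i \<le> q i \<and> q i < 1"
    and \<beta>: "\<And>i. odds_ratio (p i) (q i) = \<beta>"
    and k: "k \<le> CARD('n)"
  shows "rel_pmf (\<subseteq>) (cond_pmf (random_subset_pmf p) {S. k \<le> card S})
    (cond_pmf (random_subset_pmf q) {S. k \<le> card S})"
proof -
  define \<mu> \<nu> where "\<mu> = cond_pmf (random_subset_pmf p) {S. k \<le> card S}"
    and "\<nu> = cond_pmf (random_subset_pmf q) {S. k \<le> card S}"
  define C where "C = (\<Prod>i\<in>UNIV. (1 - p i) / (1 - q i))"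
  define a b where "a = measure (random_subset_pmf p) {S. k \<le> card S}"
    and "b = measure (random_subset_pmf q) {S. k \<le> card S}"
  have p01: "0 < p i \<and> p i < 1" and q01: "0 < q i \<and> q i < 1" for i
    using pq[of i] by auto
  have "C > 0"
    unfolding C_def using p01 q01 by (intro prod_pos) auto
  \<comment> \<open>Here \<open>undefined\<close> is just some index; \<beta> \<le> 1 because the
    odds \<open>x / (1 - x)\<close> increase with \<open>x\<close>.\<close>
  have "0 < \<beta>" "\<beta> \<le> 1"
    using p01 q01 pq[of undefined] \<beta>[of undefined, symmetric]
    by (auto simp: odds_ratio_def field_simps)
  obtain S0 :: "'n set" where S0: "card S0 = k"
    using ex_card_eq[OF k] by auto
  have ne: "set_pmf (random_subset_pmf r) \<inter> {S. k \<le> card S} \<noteq> {}"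
    if "\<And>i. 0 < r i \<and> r i < 1" for r :: "'n \<Rightarrow> real"
    using S0 by (auto simp: set_pmf_random_subset[OF that])
  have "a > 0" "b > 0"
    unfolding a_def b_def using S0
    by (auto intro!: measure_pmf_posI[of S0] simp: set_pmf_random_subset[OF p01] set_pmf_random_subset[OF q01])
  have pmf_p: "pmf (random_subset_pmf p) S = C * \<beta> ^ card S * pmf (random_subset_pmf q) S" for S
    unfolding C_def using p01 q01 \<beta> by (intro pmf_random_subset_odds_ratio) auto
  have \<mu>: "pmf \<mu> S = (if k \<le> card S then C * \<beta> ^ card S / a * pmf (random_subset_pmf q) S else 0)" for S
    by (simp add: \<mu>_def pmf_cond[OF ne[OF p01]] a_def pmf_p)
  have \<nu>: "pmf \<nu> S = (if k \<le> card S then 1 / b * pmf (random_subset_pmf q) S else 0)" for S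
    by (simp add: \<nu>_def pmf_cond[OF ne[OF q01]] b_def)
  \<comment> \<open>On sets of size at least \<open>k\<close>, the ratio of \<open>pmf \<mu>\<close>
    to \<open>pmf \<nu>\<close> is a constant times \<beta> to the power of the size, so it cannot
    increase with the size.\<close>
  have card_le: "card S \<le> card T" if less: "pmf \<mu> T * pmf \<nu> S < pmf \<mu> S * pmf \<nu> T" for S T
  proof (rule ccontr)
    assume "\<not> card S \<le> card T"
    then have "\<beta> ^ card S \<le> \<beta> ^ card T"
      using \<open>0 < \<beta>\<close> \<open>\<beta> \<le> 1\<close> by (intro power_decreasing) auto
    moreover have "pmf \<mu> S = C * b / a * \<beta> ^ card S * pmf \<nu> S" for S
      using \<open>b > 0\<close> by (simp add: \<mu> \<nu>)
    ultimately have "pmf \<mu> S * pmf \<nu> T \<le> C * b / a * \<beta> ^ card T * pmf \<nu> S * pmf \<nu> T"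
      using \<open>C > 0\<close> \<open>a > 0\<close> \<open>b > 0\<close> by (simp add: divide_right_mono mult_left_mono mult_right_mono)
    also have "\<dots> = pmf \<mu> T * pmf \<nu> S"
      using \<open>b > 0\<close> by (simp add: \<mu> \<nu> mult_ac)
    finally show False using less by simp
  qed
  \<comment> \<open>The bound \<open>k \<le> card S\<close> is recorded because size classes below
    \<open>k\<close> have no mass under either law, so conditioning on them makes no sense.\<close>
  define R where "R = (\<lambda>(S :: 'n set) (T :: 'n set). k \<le> card S \<and> card S \<le> card T)"
  have R: "rel_pmf R \<mu> \<nu>"
    using rel_pmf_pmf_mult_less
  proof (rule pmf.rel_mono_strong)
    fix S T assume "S \<in> set_pmf \<mu>" "S = T \<or> pmf \<mu> T * pmf \<nu> S < pmf \<mu> S * pmf \<nu> T"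
    then show "R S T"
      using card_le[of T S] by (auto simp: R_def \<mu>_def set_cond_pmf[OF ne[OF p01]])
  qed
  have ne_card: "set_pmf (random_subset_pmf q) \<inter> {S'. card S' = card S} \<noteq> {}" for S :: "'n set"
    by (auto simp: set_pmf_random_subset[OF q01])
  have "rel_pmf (\<subseteq>) (bind_pmf \<mu> (\<lambda>S. cond_pmf \<mu> {S'. card S' = card S}))
      (bind_pmf \<nu> (\<lambda>S. cond_pmf \<nu> {S'. card S' = card S}))"
    using R
  proof (rule rel_pmf_bindI)
    fix S T assume "R S T"
    then have ST: "k \<le> card S" "card S \<le> card T" by (auto simp: R_def)
    \<comment> \<open>Within a size class the power of \<beta> is constant and is absorbed into the
      scaling factor.\<close>
    have "cond_pmf \<mu> {S'. card S' = card S} = cond_pmf (random_subset_pmf q) {S'. card S' = card S}"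
      using ST \<open>C > 0\<close> \<open>a > 0\<close> \<open>0 < \<beta>\<close>
      by (intro cond_pmf_cong_scale[where c = "C * \<beta> ^ card S / a"] ne_card) (auto simp: \<mu>)
    moreover have "cond_pmf \<nu> {S'. card S' = card T} = cond_pmf (random_subset_pmf q) {S'. card S' = card T}"
      using ST \<open>b > 0\<close>
      by (intro cond_pmf_cong_scale[where c = "1 / b"] ne_card) (auto simp: \<nu>)
    ultimately show "rel_pmf (\<subseteq>) (cond_pmf \<mu> {S'. card S' = card S}) (cond_pmf \<nu> {S'. card S' = card T})"
      using rel_pmf_subset_cond_card[of q, OF q01 ST(2)] by (simp add: card_mono)
  qed
  then show ?thesis
    by (simp add: bind_cond_pmf_fibre \<mu>_def \<nu>_def)
qed

section \<open>Transfer to random vectors\<close>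

text \<open>The random set of coordinates equal to 1 has law \<open>random_subset_pmf p\<close>, and
  \<open>X\<close> is almost surely its indicator vector.\<close>

lemma cond_law_card_ge:
  fixes X :: "'a \<Rightarrow> real ^ 'n::finite"
  assumes X: "indep_bernoulli_vector M p X" and p: "\<And>i. 0 < p i \<and> p i < 1" and k: "k \<le> CARD('n)"
  shows "cond_law M X {\<omega> \<in> space M. real k \<le> (\<Sum>i\<in>UNIV. X \<omega> $ i)} =
    distr (cond_pmf (random_subset_pmf p) {S. k \<le> card S}) borel (\<lambda>S. \<chi> i. of_bool (i \<in> S))"
proof -
  interpret prob_space M
    using X by (simp add: indep_bernoulli_vector_def)
  have indep: "indep_vars (\<lambda>_. borel) (\<lambda>i \<omega>. X \<omega> $ i) UNIV"
    and law: "\<And>i. distr M borel (\<lambda>\<omega>. X \<omega> $ i) = bernoulli_law (p i)"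
    using X by (auto simp: indep_bernoulli_vector_def)
  have comp[measurable]: "(\<lambda>\<omega>. X \<omega> $ i) \<in> borel_measurable M" for i
    using indep by (auto simp: indep_vars_def)
  have X_meas[measurable]: "X \<in> borel_measurable M"
    by (subst borel_measurable_euclidean_space) (auto simp: Basis_vec_def inner_axis)
  define T where "T \<omega> = {i. X \<omega> $ i = 1}" for \<omega>
  have T_meas[measurable]: "T \<in> measurable M (count_space UNIV)"
  proof (subst measurable_count_space_eq2, simp, safe)
    fix S :: "'n set"
    have "T -` {S} \<inter> space M = {\<omega> \<in> space M. \<forall>i. X \<omega> $ i = 1 \<longleftrightarrow> i \<in> S}"
      by (auto simp: T_def)
    also have "\<dots> \<in> sets M" by measurable
    finally show "T -` {S} \<inter> space M \<in> sets M" .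
  qed auto
  have prob_comp: "prob ((\<lambda>\<omega>. X \<omega> $ i) -` B \<inter> space M) = measure (bernoulli_pmf (p i)) {x. of_bool x \<in> B}"
    if "B \<in> sets borel" for i and B :: "real set"
  proof -
    have "prob ((\<lambda>\<omega>. X \<omega> $ i) -` B \<inter> space M) = measure (bernoulli_law (p i)) B"
      using that by (simp add: measure_distr flip: law)
    also have "\<dots> = measure (bernoulli_pmf (p i)) {x. of_bool x \<in> B}"
      using that by (simp add: bernoulli_law_def measure_distr vimage_def)
    finally show ?thesis .
  qed
  have distr_T: "distr M (count_space UNIV) T = measure_pmf (random_subset_pmf p)"
  proof (rule measure_eqI_finite[of _ UNIV])
    fix S :: "'n set"
    \<comment> \<open>Coordinates are 0 or 1 only almost surely; with the complement of
      \<open>{1}\<close> instead of \<open>{0}\<close>, the event that \<open>T\<close> equals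
      \<open>S\<close> is exactly the intersection of the coordinate events.\<close>
    define B where "B i = (if i \<in> S then {1} else - {1 :: real})" for i
    have "prob (T -` {S} \<inter> space M) = prob (\<Inter>i\<in>UNIV. (\<lambda>\<omega>. X \<omega> $ i) -` B i \<inter> space M)"
      by (rule arg_cong[where f = prob]) (auto simp: T_def B_def split: if_splits)
    also have "\<dots> = (\<Prod>i\<in>UNIV. prob ((\<lambda>\<omega>. X \<omega> $ i) -` B i \<inter> space M))"
      by (rule indep_varsD_finite[OF indep]) (auto simp: B_def)
    also have "\<dots> = (\<Prod>i\<in>UNIV. if i \<in> S then p i else 1 - p i)"
    proof (rule prod.cong)
      fix i
      have "{x. of_bool x \<in> B i} = {i \<in> S}"
        by (auto simp: B_def of_bool_def split: if_splits)
      then show "prob ((\<lambda>\<omega>. X \<omega> $ i) -` B i \<inter> space M) = (if i \<in> S then p i else 1 - p i)"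
        using p[of i] by (subst prob_comp) (auto simp: B_def measure_pmf_single)
    qed simp
    also have "\<dots> = pmf (random_subset_pmf p) S"
      using p by (intro pmf_random_subset[symmetric]) (simp add: less_imp_le)
    finally show "emeasure (distr M (count_space UNIV) T) {S} = emeasure (random_subset_pmf p) {S}"
      by (simp add: emeasure_distr emeasure_eq_measure emeasure_pmf_single)
  qed auto
  have "AE \<omega> in M. X \<omega> $ i = 0 \<or> X \<omega> $ i = 1" for i
  proof -
    have "AE x in distr M borel (\<lambda>\<omega>. X \<omega> $ i). x = 0 \<or> x = 1"
      unfolding law bernoulli_law_def by (subst AE_distr_iff) auto
    then show ?thesis by (subst (asm) AE_distr_iff) auto
  qed
  then have "AE \<omega> in M. \<forall>i. X \<omega> $ i = 0 \<or> X \<omega> $ i = 1"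
    by (simp add: AE_all_countable)
  then have AE_X: "AE \<omega> in M. X \<omega> = (\<chi> i. of_bool (i \<in> T \<omega>))"
    by eventually_elim (auto simp: vec_eq_iff T_def of_bool_def)
  define A where "A = {\<omega> \<in> space M. real k \<le> (\<Sum>i\<in>UNIV. X \<omega> $ i)}"
  have A[measurable]: "A \<in> sets M"
    unfolding A_def by measurable
  define v where "v = (\<lambda>S. \<chi> i. of_bool (i \<in> S) :: real ^ 'n)"
  \<comment> \<open>This gives the numerator of the conditional probability, and with
    \<open>B = UNIV\<close> also the denominator.\<close>
  have emeasure_A: "emeasure M (A \<inter> (X -` B \<inter> space M)) =
      emeasure (random_subset_pmf p) ({S. k \<le> card S} \<inter> v -` B)" if [measurable]: "B \<in> sets borel" for B
  proof -
    have "emeasure M (A \<inter> (X -` B \<inter> space M)) = emeasure M (T -` ({S. k \<le> card S} \<inter> v -` B) \<inter> space M)"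
    proof (rule emeasure_eq_AE)
      show "AE \<omega> in M. \<omega> \<in> A \<inter> (X -` B \<inter> space M) \<longleftrightarrow> \<omega> \<in> T -` ({S. k \<le> card S} \<inter> v -` B) \<inter> space M"
        using AE_X
      proof eventually_elim
        case (elim \<omega>)
        then have "(\<Sum>i\<in>UNIV. X \<omega> $ i) = real (card (T \<omega>))"
          by (metis (no_types, lifting) vec_lambda_beta sum.cong sum_of_bool_eq finite Collect_mem_eq Int_UNIV_left)
        with elim show ?case by (simp add: A_def v_def conj_ac)
      qed
    qed measurable
    also have "\<dots> = emeasure (random_subset_pmf p) ({S. k \<le> card S} \<inter> v -` B)"
      unfolding distr_T[symmetric] by (subst emeasure_distr) auto
    finally show ?thesis .
  qed
  have ne: "set_pmf (random_subset_pmf p) \<inter> {S. k \<le> card S} \<noteq> {}"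
    using ex_card_eq[OF k] by (auto simp: set_pmf_random_subset[OF p])
  have "distr (uniform_measure M A) borel X = distr (cond_pmf (random_subset_pmf p) {S. k \<le> card S}) borel v"
  proof (rule measure_eqI)
    fix B assume "B \<in> sets (distr (uniform_measure M A) borel X)"
    then have B[measurable]: "B \<in> sets borel" by simp
    have "emeasure M A = emeasure (random_subset_pmf p) {S. k \<le> card S}"
      using emeasure_A[of UNIV] sets.sets_into_space[OF A] by (simp add: Int_absorb2)
    then show "emeasure (distr (uniform_measure M A) borel X) B =
        emeasure (distr (cond_pmf (random_subset_pmf p) {S. k \<le> card S}) borel v) B"
      using emeasure_A[OF B]
      by (simp add: emeasure_distr cond_pmf.rep_eq[OF ne])
  qed simp
  then show ?thesis
    by (simp add: cond_law_def A_def v_def)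
qed

text \<open>Applying \<open>v\<close> to both components of a coupling of \<mu> and \<nu> couples
  the image laws.\<close>

lemma stoch_dominated_of_rel_pmf:
  fixes v :: "'s \<Rightarrow> real ^ 'n::finite"
  assumes "rel_pmf R \<mu> \<nu>" and mono: "\<And>x y. R x y \<Longrightarrow> v x \<le> v y"
  shows "distr \<mu> borel v \<preceq>\<^sub>s\<^sub>t distr \<nu> borel v"
proof -
  from assms(1) obtain r where r: "\<And>x y. (x, y) \<in> set_pmf r \<Longrightarrow> R x y"
    and \<mu>: "map_pmf fst r = \<mu>" and \<nu>: "map_pmf snd r = \<nu>"
    by (auto elim: rel_pmf.cases)
  have "distr r borel (v \<circ> fst) \<preceq>\<^sub>s\<^sub>t distr r borel (v \<circ> snd)"
    by (rule stoch_dominatedI) (auto simp: measure_pmf.prob_space_axioms AE_measure_pmf_iff intro!: mono dest: r)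
  then show ?thesis
    by (simp add: map_pmf_rep_eq distr_distr flip: \<mu> \<nu>)
qed

theorem proposition1p3:
  fixes M :: "'a measure" and N :: "'b measure"
    and X :: "'a \<Rightarrow> real ^ 'n::finite" and Y :: "'b \<Rightarrow> real ^ 'n"
    and p q :: "'n \<Rightarrow> real" and k :: nat
  assumes X: "indep_bernoulli_vector M p X"
    and Y: "indep_bernoulli_vector N q Y"
    and pq: "\<forall>i. 0 < p i \<and> p i \<le> q i \<and> q i < 1"
    and beta: "\<forall>i j. odds_ratio (p i) (q i) = odds_ratio (p j) (q j)"
    and k: "k \<le> CARD('n)"
  shows "cond_law M X {\<omega> \<in> space M. (\<Sum>i\<in>UNIV. X \<omega> $ i) \<ge> real k}
         \<preceq>\<^sub>s\<^sub>t cond_law N Y {\<omega> \<in> space N. (\<Sum>i\<in>UNIV. Y \<omega> $ i) \<ge> real k}"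
proof -
  obtain \<beta> where \<beta>: "odds_ratio (p i) (q i) = \<beta>" for i
    using beta by blast
  have p01: "0 < p i \<and> p i < 1" and q01: "0 < q i \<and> q i < 1" for i
    using pq[rule_format, of i] by auto
  have "rel_pmf (\<subseteq>) (cond_pmf (random_subset_pmf p) {S. k \<le> card S})
      (cond_pmf (random_subset_pmf q) {S. k \<le> card S})"
    using pq \<beta> k by (intro rel_pmf_subset_cond_card_ge) auto
  then show ?thesis
    unfolding cond_law_card_ge[OF X p01 k] cond_law_card_ge[OF Y q01 k]
    by (rule stoch_dominated_of_rel_pmf) (auto simp: less_eq_vec_def of_bool_def)
qed

end
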